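(* Let $n\ge 1$ be an integer with $n\neq 6$, let $G=S_n$, let $F$ be a field containing a primitive $n$-th root of $1$, let $r$ be a ramification of $G$, and let $u_0:\mathcal K(G)\to G$ be a map with $u_0(C)\in C$ for every $C\in\mathcal K(G)$. Let $\bar\Omega(G,r,u_0)$ be a subset of $\{(G,r,\overrightarrow{\chi},u_0) : (G,r,\overrightarrow{\chi},u_0)\text{ is an RSC}\}$ which contains exactly one element of each type occurring in this set. Then $\bar\Omega(G,r,u_0)$ is a set of representatives of the isomorphism classes of $\Omega(G,r)$, i.e. every element of $\Omega(G,r)$ is isomorphic to exactly one element of $\bar\Omega(G,r,u_0)$.
   Context: For a finite group $G$, $\mathcal K(G)$ is the set of conjugacy classes of $G$, $Z_x$ is the centralizer of $x\in G$, and $\widehat H$ denotes the set of group homomorphisms $H\to F\setminus\{0\}$ (characters of one-dimensional representations over $F$). A ramification of $G$ is a formal sum $r=\sum_{C\in\mathcal K(G)}r_C C$ with each $r_C$ a non-negative integer. For each $C$ a set $I_C(r)$ with $|I_C(r)|=r_C$ is fixed, and $\mathcal K_r(G)=\{C\in\mathcal K(G): r_C\neq 0\}$. A ramification system with characters (RSC) is a quadruple $(G,r,\overrightarrow{\chi},u)$ where $r$ is a ramification of $G$, $u:\mathcal K(G)\to G$ is a map with $u(C)\in C$ for every $C\in\mathcal K(G)$, and $\overrightarrow{\chi}=\{\chi_C^{(i)}\}_{i\in I_C(r),\,C\in\mathcal K_r(G)}$ is a family with $\chi_C^{(i)}\in\widehat{Z_{u(C)}}$. Two RSC's $(G,r,\overrightarrow{\chi},u)$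 and $(G',r',\overrightarrow{\chi'},u')$ are isomorphic if: (i) there is a group isomorphism $\phi:G\to G'$; (ii) for every $C\in\mathcal K(G)$ there is $h_C\in G$ with $\phi(h_Cu(C)h_C^{-1})=u'(\phi(C))$; (iii) for every $C\in\mathcal K_r(G)$ there is a bijection $\phi_C:I_C(r)\to I_{\phi(C)}(r')$ such that $\chi_{\phi(C)}^{\prime(\phi_C(i))}(\phi(h_Chh_C^{-1}))=\chi_C^{(i)}(h)$ for all $h\in Z_{u(C)}$ and all $i\in I_C(r)$ (with the same $\phi$ and $h_C$ as in (i), (ii)). For a fixed ramification $r$ of $G$, $\Omega(G,r)$ is the set of all RSC's $(G,r,\overrightarrow{\chi},u)$. Type: for each $C\in\mathcal K_r(G)$ fix an enumeration $\widehat{Z_{u_0(C)}}=\{\xi_{u_0(C)}^{(i)} : i=1,\dots,\gamma_C\}$ with $\gamma_C=|\widehat{Z_{u_0(C)}}|$. The type of an RSC $(G,r,\overrightarrow{\chi},u_0)$ is the family $\{(n_1,n_2,\dots,n_{\gamma_C})\}_{C\in\mathcal K_r(G)}$, where, for each $C$, $n_i=|\{j\in I_C(r): \chi_C^{(j)}=\xi_{u_0(C)}^{(i)}\}|$ for $1\le i\le\gamma_C$. *)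

theory Defs
  imports "HOL-Algebra.Algebra"
begin

definition conjugacy_class :: "('a, 'm) monoid_scheme \<Rightarrow> 'a \<Rightarrow> 'a set" where
  "conjugacy_class G x = {g \<otimes>\<^bsub>G\<^esub> x \<otimes>\<^bsub>G\<^esub> inv\<^bsub>G\<^esub> g | g. g \<in> carrier G}"

definition conjugacy_classes :: "('a, 'm) monoid_scheme \<Rightarrow> 'a set set" where
  "conjugacy_classes G = conjugacy_class G ` carrier G"

definition centralizer :: "('a, 'm) monoid_scheme \<Rightarrow> 'a \<Rightarrow> 'a set" where
  "centralizer G x = {g \<in> carrier G. g \<otimes>\<^bsub>G\<^esub> x = x \<otimes>\<^bsub>G\<^esub> g}"

text \<open>Characters of the subgroup \<open>H\<close> of \<open>G\<close> with values in \<open>F - {0}\<close>. Here and below,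
  functions with a restricted domain are made extensional, so that HOL equality of two of them is
  equality as functions on that domain (this matters for counting and for uniqueness).\<close>

definition characters ::
    "('f, 'k) ring_scheme \<Rightarrow> ('a, 'm) monoid_scheme \<Rightarrow> 'a set \<Rightarrow> ('a \<Rightarrow> 'f) set" where
  "characters F G H = hom (G\<lparr>carrier := H\<rparr>) (Multiplicative_Group.mult_of F) \<inter> extensional H"

text \<open>The formal sum of the \<open>r\<^sub>C C\<close> is its coefficient function.\<close>

definition ramifications :: "('a, 'm) monoid_scheme \<Rightarrow> ('a set \<Rightarrow> nat) set" where
  "ramifications G = conjugacy_classes G \<rightarrow>\<^sub>E UNIV"

definition ram_support ::
    "('a, 'm) monoid_scheme \<Rightarrow> ('a set \<Rightarrow> nat) \<Rightarrow> 'a set set" where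
  "ram_support G r = {C \<in> conjugacy_classes G. r C \<noteq> 0}"

text \<open>\<open>I r C\<close> is the fixed set of cardinality \<open>r C\<close> that indexes the characters over \<open>C\<close>;
  the choice \<open>I\<close> is a parameter of everything below.\<close>

definition index_sets ::
    "('a, 'm) monoid_scheme \<Rightarrow> ('a set \<Rightarrow> nat) \<Rightarrow> (('a set \<Rightarrow> nat) \<Rightarrow> 'a set \<Rightarrow> 'i set) \<Rightarrow> bool"
  where
  "index_sets G r I \<longleftrightarrow> (\<forall>C\<in>conjugacy_classes G. finite (I r C) \<and> card (I r C) = r C)"

type_synonym ('a, 'f, 'i) quadruple =
  "'a monoid \<times> ('a set \<Rightarrow> nat) \<times> ('a set \<Rightarrow> 'i \<Rightarrow> 'a \<Rightarrow> 'f) \<times> ('a set \<Rightarrow> 'a)"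

definition class_representative_maps :: "('a, 'm) monoid_scheme \<Rightarrow> ('a set \<Rightarrow> 'a) set" where
  "class_representative_maps G = (\<Pi>\<^sub>E C\<in>conjugacy_classes G. C)"

definition is_RSC ::
    "('f, 'k) ring_scheme \<Rightarrow> (('a set \<Rightarrow> nat) \<Rightarrow> 'a set \<Rightarrow> 'i set) \<Rightarrow> ('a, 'f, 'i) quadruple \<Rightarrow> bool"
  where
  "is_RSC F I = (\<lambda>(G, r, \<chi>, u).
     group G \<and> finite (carrier G) \<and>
     r \<in> ramifications G \<and>
     u \<in> class_representative_maps G \<and>
     \<chi> \<in> (\<Pi>\<^sub>E C\<in>ram_support G r. \<Pi>\<^sub>E i\<in>I r C. characters F G (centralizer G (u C))))"

text \<open>\<open>I\<close> and \<open>I'\<close> are the index sets for the two groups, which may have different types.\<close>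

definition RSC_isomorphic ::
    "(('a set \<Rightarrow> nat) \<Rightarrow> 'a set \<Rightarrow> 'i set) \<Rightarrow> (('b set \<Rightarrow> nat) \<Rightarrow> 'b set \<Rightarrow> 'j set) \<Rightarrow>
     ('a, 'f, 'i) quadruple \<Rightarrow> ('b, 'f, 'j) quadruple \<Rightarrow> bool" where
  "RSC_isomorphic I I' = (\<lambda>(G, r, \<chi>, u) (G', r', \<chi>', u').
     \<exists>\<phi> \<in> iso G G'. \<exists>h \<in> conjugacy_classes G \<rightarrow> carrier G.
       (\<forall>C\<in>conjugacy_classes G.
          \<phi> (h C \<otimes>\<^bsub>G\<^esub> u C \<otimes>\<^bsub>G\<^esub> inv\<^bsub>G\<^esub> h C) = u' (\<phi> ` C)) \<and>
       (\<forall>C\<in>ram_support G r. \<exists>b. bij_betw b (I r C) (I' r' (\<phi> ` C)) \<and>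
          (\<forall>x\<in>centralizer G (u C). \<forall>i\<in>I r C.
             \<chi>' (\<phi> ` C) (b i) (\<phi> (h C \<otimes>\<^bsub>G\<^esub> x \<otimes>\<^bsub>G\<^esub> inv\<^bsub>G\<^esub> h C)) = \<chi> C i x)))"

definition Omega ::
    "('f, 'k) ring_scheme \<Rightarrow> (('a set \<Rightarrow> nat) \<Rightarrow> 'a set \<Rightarrow> 'i set) \<Rightarrow>
     'a monoid \<Rightarrow> ('a set \<Rightarrow> nat) \<Rightarrow> ('a, 'f, 'i) quadruple set" where
  "Omega F I G r = {(G, r, \<chi>, u) | \<chi> u. is_RSC F I (G, r, \<chi>, u)}"

definition Omega_at ::
    "('f, 'k) ring_scheme \<Rightarrow> (('a set \<Rightarrow> nat) \<Rightarrow> 'a set \<Rightarrow> 'i set) \<Rightarrow>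
     'a monoid \<Rightarrow> ('a set \<Rightarrow> nat) \<Rightarrow> ('a set \<Rightarrow> 'a) \<Rightarrow> ('a, 'f, 'i) quadruple set" where
  "Omega_at F I G r u\<^sub>0 = {(G, r, \<chi>, u\<^sub>0) | \<chi>. is_RSC F I (G, r, \<chi>, u\<^sub>0)}"

definition num_characters ::
    "('f, 'k) ring_scheme \<Rightarrow> ('a, 'm) monoid_scheme \<Rightarrow> ('a set \<Rightarrow> 'a) \<Rightarrow> 'a set \<Rightarrow> nat" where
  "num_characters F G u C = card (characters F G (centralizer G (u C)))"

definition character_enumeration ::
    "('f, 'k) ring_scheme \<Rightarrow> ('a, 'm) monoid_scheme \<Rightarrow> ('a set \<Rightarrow> nat) \<Rightarrow> ('a set \<Rightarrow> 'a) \<Rightarrow>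
     ('a set \<Rightarrow> nat \<Rightarrow> 'a \<Rightarrow> 'f) \<Rightarrow> bool" where
  "character_enumeration F G r u \<xi> \<longleftrightarrow>
     (\<forall>C\<in>ram_support G r.
        bij_betw (\<xi> C) {1..num_characters F G u C} (characters F G (centralizer G (u C))))"

text \<open>The tuple \<open>(n\<^sub>1, \<dots>, n\<^sub>\<gamma>)\<close> over each class in the support is a list of length
  \<open>num_characters F G u C\<close>. The type is meant for a \<open>\<xi>\<close> that enumerates the characters with
  respect to the given \<open>u\<close>.\<close>

definition RSC_type ::
    "('f, 'k) ring_scheme \<Rightarrow> (('a set \<Rightarrow> nat) \<Rightarrow> 'a set \<Rightarrow> 'i set) \<Rightarrow>
     ('a set \<Rightarrow> nat \<Rightarrow> 'a \<Rightarrow> 'f) \<Rightarrow> ('a, 'f, 'i) quadruple \<Rightarrow> 'a set \<Rightarrow> nat list" where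
  "RSC_type F I \<xi> = (\<lambda>(G, r, \<chi>, u).
     \<lambda>C\<in>ram_support G r.
       map (\<lambda>k. card {j \<in> I r C. \<chi> C j = \<xi> C k}) [1..<Suc (num_characters F G u C)])"

end

theory Submission
  imports Defs
begin

text \<open>
  The statement rests on two facts.

  The first is that every automorphism of the symmetric group on \<open>n \<noteq> 6\<close> points is inner. The product
  of a transposition with any of its conjugates has order 1, 2 or 3. Every other involution has a
  conjugate such that the product contains a cycle of length 4 or 5, except for the fixed point
  free involutions on four points, which are recognised by commuting with all their conjugates, and
  on six points, the excluded case (\<open>transposition_if_conjugate_products\<close>). So an automorphism
  permutes the transpositions, it preserves whether two of them share a point, and from the images
  of the transpositions at one point (\<open>star_image\<close>) a conjugating permutation can be
  read off (\<open>symmetric_automorphism.inner\<close>).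

  The second holds for any finite group with inner automorphisms only. Choose elements \<open>h C\<close> that
  conjugate the representatives \<open>u C\<close> of a system \<open>R\<close> to the prescribed \<open>u\<^sub>0 C\<close> and transport the
  characters of \<open>R\<close> along them. Any isomorphism from \<open>R\<close> to a system over \<open>u\<^sub>0\<close> fixes every conjugacy
  class and differs from this transport only by conjugations with elements of the centralizers of
  the \<open>u\<^sub>0 C\<close>, under which one-dimensional characters are invariant. Hence \<open>R\<close> is isomorphic to a
  system over \<open>u\<^sub>0\<close> if and only if that system has, over each class, the same characters with the
  same multiplicities as the transported one, that is, the same type
  (\<open>RSC_isomorphic_iff_RSC_type_transport_eq\<close>).
\<close>

section \<open>Conjugates of transpositions and of other involutions\<close>

lemma conj_transpose:
  assumes "bij g"
  shows "g \<circ> transpose a b \<circ> inv' g = transpose (g a) (g b)"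
  using transpose_comp_eq[OF assms, of "g a" "g b"] assms
  by (metis bij_is_inj comp_assoc comp_id inv_f_f inv_o_cancel bij_is_surj surj_iff)

lemma conj_apply:
  assumes "bij g"
  shows "(g \<circ> t \<circ> inv' g) (g x) = g (t x)"
  using assms by (simp add: bij_is_inj)

lemma funpow_6_eq_id:
  assumes "f \<circ> f = id \<or> f \<circ> f \<circ> f = id"
  shows "f ^^ 6 = id"
proof -
  have "f ^^ 6 = (f \<circ> f) \<circ> (f \<circ> f) \<circ> (f \<circ> f)" "f ^^ 6 = (f \<circ> f \<circ> f) \<circ> (f \<circ> f \<circ> f)"
    by (simp_all add: numeral_eq_Suc comp_assoc)
  with assms show ?thesis by (metis comp_id)
qed

text \<open>Two transpositions are disjoint, share one point or coincide, so their product has order 2, 3 or 1.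
  The exponent 6 is the least common multiple, which makes this a single equation that any
  automorphism preserves.\<close>

lemma transpose_product_pow_6: "(transpose a b \<circ> transpose c d) ^^ 6 = id"
proof -
  have meet: "(transpose a b \<circ> transpose a c) ^^ 6 = id" for a b c :: 'a
  proof (rule funpow_6_eq_id, cases "distinct [a, b, c]")
    case True
    let ?f = "transpose a b \<circ> transpose a c"
    have "(?f \<circ> ?f \<circ> ?f) x = x" for x
    proof (cases "x \<in> {a, b, c}")
      case True
      with \<open>distinct [a, b, c]\<close> show ?thesis by auto
    qed auto
    then show "?f \<circ> ?f = id \<or> ?f \<circ> ?f \<circ> ?f = id" by (simp add: fun_eq_iff)
  next
    case False
    then show "(transpose a b \<circ> transpose a c) \<circ> (transpose a b \<circ> transpose a c) = id \<or>
      (transpose a b \<circ> transpose a c) \<circ> (transpose a b \<circ> transpose a c) \<circ> (transpose a b \<circ> transpose a c) = id"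
      by auto
  qed
  show ?thesis
  proof (cases "{a, b} \<inter> {c, d} = {}")
    case True
    then have "transpose a b \<circ> transpose c d = transpose c d \<circ> transpose a b"
      by (auto simp: fun_eq_iff transpose_def)
    then have "(transpose a b \<circ> transpose c d) \<circ> (transpose a b \<circ> transpose c d)
        = transpose a b \<circ> (transpose a b \<circ> transpose c d) \<circ> transpose c d"
      by (metis comp_assoc)
    also have "\<dots> = id" by (simp add: fun_eq_iff)
    finally show ?thesis by (intro funpow_6_eq_id) simp
  next
    case False
    then consider "a = c" | "a = d" | "b = c" | "b = d" by auto
    then show ?thesis
      using meet[of a b d] meet[of a b c] meet[of b a d] meet[of b a c]
      by cases (simp_all only: transpose_commute)
  qed
qed
text \<open>On four points the fixed point free involutions form, with the identity, the Klein four group.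
  Where \<open>s\<close> and \<open>t\<close> disagree at \<open>x\<close>, the points \<open>x, s x, t x, s (t x)\<close> exhaust \<open>S\<close>, and \<open>t (s x)\<close>
  can only be the last of them.\<close>

lemma fixpoint_free_involutions_commute:
  assumes S: "card S = 4"
    and s: "s permutes S" "s \<circ> s = id" "\<And>x. x \<in> S \<Longrightarrow> s x \<noteq> x"
    and t: "t permutes S" "t \<circ> t = id" "\<And>x. x \<in> S \<Longrightarrow> t x \<noteq> x"
  shows "s \<circ> t = t \<circ> s"
proof
  fix x
  have ss: "s (s y) = y" and tt: "t (t y) = y" for y
    using s(2) t(2) by (metis comp_apply id_apply)+
  have fin: "finite S" using S by (metis card.infinite zero_neq_numeral)
  show "(s \<circ> t) x = (t \<circ> s) x"
  proof (cases "x \<in> S \<and> s x \<noteq> t x")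
    case False
    then show ?thesis
      using s(1) t(1) ss tt by (metis comp_apply permutes_not_in)
  next
    case True
    have inS: "s y \<in> S" "t y \<in> S" if "y \<in> S" for y
      using that s(1) t(1) by (simp_all add: permutes_in_image)
    have d: "distinct [x, s x, t x, s (t x)]"
      using True inS s(3) t(3) ss by (auto) (metis ss)+
    have sub: "{x, s x, t x, s (t x)} \<subseteq> S" using True inS by auto
    have "card {x, s x, t x, s (t x)} = 4"
      using distinct_card[OF d] by simp
    then have "{x, s x, t x, s (t x)} = S"
      using card_subset_eq[OF fin sub] S by simp
    moreover have "t (s x) \<in> S" using True inS by simp
    moreover have "t (s x) \<noteq> x" "t (s x) \<noteq> s x" "t (s x) \<noteq> t x"
      using True inS s(3) t(3) tt by metis+
    ultimately show ?thesis by auto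
  qed
qed

text \<open>A transposition can be told from other involutions by the orders of its products with its own
  conjugates. If \<open>t\<close> moves two pairs \<open>{a, b}\<close> and \<open>{c, d}\<close> and fixes a point \<open>e\<close>, then
  conjugating by the cycle \<open>(a b c d e)\<close> gives a conjugate whose product with \<open>t\<close> contains a 5-cycle.
  If \<open>t\<close> has no fixed point but moves four pairs, conjugating by the 8-cycle through them gives a
  product containing a 4-cycle. What remains are fixed point free involutions on four points, which
  the condition \<open>four\<close> rules out, and on six points, where the claim fails: there the triple
  transpositions form the class that the outer automorphisms of the symmetric group exchange with
  the transpositions.\<close>

lemma transposition_if_conjugate_products:
  assumes fin: "finite S" and card: "card S \<noteq> 6"
    and t: "t permutes S" "t \<circ> t = id" "t \<noteq> id"
    and pow: "\<And>g. g permutes S \<Longrightarrow> (t \<circ> (g \<circ> t \<circ> inv' g)) ^^ 6 = id"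
    and four: "card S = 4 \<Longrightarrow> \<exists>g. g permutes S \<and> t \<circ> (g \<circ> t \<circ> inv' g) \<noteq> (g \<circ> t \<circ> inv' g) \<circ> t"
  shows "\<exists>a\<in>S. \<exists>b\<in>S. a \<noteq> b \<and> t = transpose a b"
proof (rule ccontr)
  assume no: "\<not> ?thesis"
  have tt [simp]: "t (t x) = x" for x
    using t(2) by (metis comp_apply id_apply)
  have inS: "t x \<in> S" if "x \<in> S" for x
    using that t(1) by (simp add: permutes_in_image)
  have moved_in: "x \<in> S" if "t x \<noteq> x" for x
    using that t(1) by (metis permutes_not_in)
  obtain a where a: "t a \<noteq> a" using t(3) by (auto simp: fun_eq_iff)
  define b where "b = t a"
  have ab: "a \<in> S" "b \<in> S" "a \<noteq> b" "t a = b" "t b = a"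
    using a moved_in inS by (auto simp: b_def)
  then have "t \<noteq> transpose a b" using no by blast
  then obtain c where c: "t c \<noteq> transpose a b c" by (auto simp: fun_eq_iff)
  then have c': "c \<noteq> a" "c \<noteq> b" "t c \<noteq> c"
    using ab by (auto simp: transpose_def split: if_splits)
  define d where "d = t c"
  have cd: "c \<in> S" "d \<in> S" "t c = d" "t d = c"
    using c' moved_in inS by (auto simp: d_def)
  have d4: "distinct [a, b, c, d]"
    using c' cd ab by auto
  show False
  proof (cases "\<exists>e\<in>S. t e = e")
    case True
    then obtain e where e: "e \<in> S" "t e = e" by auto
    have d5: "distinct [a, b, c, d, e]" using d4 e ab cd by auto
    define g where "g = cycle_of_list [a, b, c, d, e]"
    have g: "g permutes S"
      unfolding g_def using cycle_permutes[of "[a, b, c, d, e]"] ab cd e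
      by (auto intro: permutes_subset)
    have ge: "g a = b" "g b = c" "g c = d" "g d = e" "g e = a"
      using d5 by (auto simp: g_def transpose_def)
    define t' where "t' = g \<circ> t \<circ> inv' g"
    have t': "t' (g x) = g (t x)" for x
      unfolding t'_def by (rule conj_apply) (rule permutes_bij[OF g])
    have "t' b = c" "t' c = b" "t' d = e" "t' e = d" "t' a = a"
      using t'[of a] t'[of b] t'[of c] t'[of d] t'[of e] ge ab cd e by auto
    \<comment> \<open>The product sends \<open>a, b, d, e, c\<close> cyclically, and 6 is 1 modulo 5.\<close>
    then have "((t \<circ> t') ^^ 6) a = b"
      using ab cd e by (simp add: numeral_eq_Suc)
    moreover have "((t \<circ> t') ^^ 6) a = a" using pow[OF g] by (simp add: t'_def)
    ultimately show False using ab by simp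
  next
    case False
    then have nofix: "t x \<noteq> x" if "x \<in> S" for x using that by auto
    show False
    proof (cases "S = {a, b, c, d}")
      case True
      then have "card S = 4" using distinct_card[OF d4] by simp
      then obtain g where g: "g permutes S"
        and ne: "t \<circ> (g \<circ> t \<circ> inv' g) \<noteq> (g \<circ> t \<circ> inv' g) \<circ> t"
        using four by auto
      have "t \<circ> (g \<circ> t \<circ> inv' g) = (g \<circ> t \<circ> inv' g) \<circ> t"
      proof (rule fixpoint_free_involutions_commute[OF \<open>card S = 4\<close> t(1,2) nofix])
        show "g \<circ> t \<circ> inv' g permutes S"
          using g t(1) by (intro permutes_compose permutes_inv)
        show "(g \<circ> t \<circ> inv' g) \<circ> (g \<circ> t \<circ> inv' g) = id"
          using permutes_inverses[OF g] by (auto simp: fun_eq_iff)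
        show "(g \<circ> t \<circ> inv' g) x \<noteq> x" if "x \<in> S" for x
          using that nofix[of "inv' g x"] g
          by (metis comp_apply permutes_in_image permutes_inv permutes_inverses(1,2))
      qed
      with ne show False by simp
    next
      case False
      then obtain e where e: "e \<in> S" "e \<notin> {a, b, c, d}" using ab cd by auto
      define f where "f = t e"
      have ef: "f \<in> S" "t e = f" "t f = e" "f \<noteq> e" using e inS nofix by (auto simp: f_def)
      have d6: "distinct [a, b, c, d, e, f]"
        using d4 e ef ab cd by auto
      have "card {a, b, c, d, e, f} = 6" using distinct_card[OF d6] by simp
      then have "S \<noteq> {a, b, c, d, e, f}" using card by auto
      then obtain k where k: "k \<in> S" "k \<notin> {a, b, c, d, e, f}" using ab cd e ef by auto
      define l where "l = t k"
      have kl: "l \<in> S" "t k = l" "t l = k" "l \<noteq> k" using k inS nofix by (auto simp: l_def)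
      have d8: "distinct [a, b, c, d, e, f, k, l]"
        using d6 e ef ab cd k kl by auto
      define g where "g = cycle_of_list [a, b, c, d, e, f, k, l]"
      have g: "g permutes S"
        unfolding g_def using cycle_permutes[of "[a, b, c, d, e, f, k, l]"] ab cd e ef k kl
        by (auto intro: permutes_subset)
      have ge: "g a = b" "g b = c" "g c = d" "g d = e" "g e = f" "g f = k" "g k = l" "g l = a"
        using d8 by (auto simp: g_def transpose_def)
      define t' where "t' = g \<circ> t \<circ> inv' g"
      have t': "t' (g x) = g (t x)" for x
        unfolding t'_def by (rule conj_apply) (rule permutes_bij[OF g])
      have "t' b = c" "t' c = b" "t' d = e" "t' e = d" "t' f = k" "t' k = f" "t' l = a" "t' a = l"
        using t'[of a] t'[of b] t'[of c] t'[of d] t'[of e] t'[of f] t'[of k] t'[of l]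
          ge ab cd e ef kl by auto
      \<comment> \<open>The product sends \<open>a, k, e, c\<close> cyclically, and 6 is 2 modulo 4.\<close>
      then have "((t \<circ> t') ^^ 6) a = e"
        using ab cd ef kl by (simp add: numeral_eq_Suc)
      moreover have "((t \<circ> t') ^^ 6) a = a" using pow[OF g] by (simp add: t'_def)
      ultimately show False using e by simp
    qed
  qed
qed

section \<open>Automorphisms of symmetric groups\<close>

text \<open>The transpositions that move one chosen point \<open>x\<close> generate all permutations, because
  \<open>(a b) = (x a) (x b) (x a)\<close>. An automorphism is therefore determined by its values on them.\<close>

lemma permutes_split_star:
  assumes p: "p permutes S" and fin: "finite S" and x: "x \<in> S"
    and id: "P id"
    and star: "\<And>i q. i \<in> S \<Longrightarrow> i \<noteq> x \<Longrightarrow> q permutes S \<Longrightarrow> P q \<Longrightarrow> P (transpose x i \<circ> q)"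
  shows "P p"
  using p fin
proof (induction rule: permutes_induct)
  case id
  show ?case by (fact assms(4))
next
  case (swap a b p)
  have st: "transpose x i permutes S" if "i \<in> S" for i
    using that x by (rule permutes_swap_id[rotated])
  show ?case
  proof (cases "a = x \<or> b = x")
    case True
    then show ?thesis
      using star[of a p] star[of b p] swap by (metis transpose_commute)
  next
    case False
    then have *: "transpose a b \<circ> p = transpose x a \<circ> (transpose x b \<circ> (transpose x a \<circ> p))"
      using swap(3) by (auto simp: fun_eq_iff transpose_def)
    show ?thesis
      unfolding * using False swap st by (intro star permutes_compose) auto
  qed
qed

text \<open>An automorphism of the group of all permutations of \<open>S\<close>, written with functions rather than with
  a group record so that arbitrary finite sets \<open>S\<close> and the library on permutations can be used directly.\<close>

locale symmetric_automorphism =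
  fixes S :: "'a set" and \<phi> :: "('a \<Rightarrow> 'a) \<Rightarrow> 'a \<Rightarrow> 'a"
  assumes fin: "finite S" and card_ne_6: "card S \<noteq> 6"
    and bij: "bij_betw \<phi> {p. p permutes S} {p. p permutes S}"
    and comp: "p permutes S \<Longrightarrow> q permutes S \<Longrightarrow> \<phi> (p \<circ> q) = \<phi> p \<circ> \<phi> q"
begin

lemma permutes: "p permutes S \<Longrightarrow> \<phi> p permutes S"
  using bij by (auto simp: bij_betw_def)

lemma inject: "p permutes S \<Longrightarrow> q permutes S \<Longrightarrow> \<phi> p = \<phi> q \<longleftrightarrow> p = q"
  using bij by (auto simp: bij_betw_def inj_on_def)

lemma surject: "q permutes S \<Longrightarrow> \<exists>p. p permutes S \<and> \<phi> p = q"
  using bij by (auto simp: bij_betw_def image_iff set_eq_iff) metis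

lemma map_id: "\<phi> id = id"
proof -
  have "\<phi> id \<circ> \<phi> id = \<phi> id" using comp[OF permutes_id permutes_id] by simp
  then have "inv' (\<phi> id) \<circ> \<phi> id \<circ> \<phi> id = inv' (\<phi> id) \<circ> \<phi> id" by (simp add: comp_assoc)
  then show ?thesis using permutes_inv_o(2)[OF permutes[OF permutes_id]] by simp
qed

lemma map_inv:
  assumes p: "p permutes S"
  shows "\<phi> (inv' p) = inv' (\<phi> p)"
proof -
  have "\<phi> (inv' p) \<circ> \<phi> p = id"
    using comp[OF permutes_inv[OF p] p] permutes_inv_o(2)[OF p] map_id by simp
  then show ?thesis
    using permutes_inv_o(1)[OF permutes[OF p]] by (metis comp_assoc comp_id id_comp)
qed

lemma map_funpow:
  assumes p: "p permutes S"
  shows "\<phi> (p ^^ k) = \<phi> p ^^ k"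
proof (induction k)
  case (Suc k)
  have "(p ^^ k) permutes S" using p by (induction k) (auto intro: permutes_id permutes_compose)
  then show ?case using Suc comp[OF p] by (metis funpow.simps(2))
qed (simp add: map_id flip: id_def)

lemma map_conj:
  assumes "p permutes S" "g permutes S"
  shows "\<phi> (g \<circ> p \<circ> inv' g) = \<phi> g \<circ> \<phi> p \<circ> inv' (\<phi> g)"
  using assms by (simp add: comp permutes_compose permutes_inv map_inv)

text \<open>The condition on products of conjugates is invariant under automorphisms, since \<open>\<phi>\<close> maps the
  conjugates of a transposition \<open>s\<close> onto those of \<open>\<phi> s\<close>. For four points, the extra condition is that
  \<open>s\<close> does not commute with all its conjugates, and this is invariant for the same reason.\<close>

lemma transposition_image:
  assumes x: "x \<in> S" and y: "y \<in> S" and ne: "x \<noteq> y"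
  shows "\<exists>a\<in>S. \<exists>b\<in>S. a \<noteq> b \<and> \<phi> (transpose x y) = transpose a b"
proof -
  let ?s = "transpose x y"
  let ?t = "\<phi> ?s"
  have s: "?s permutes S" using x y by (rule permutes_swap_id)
  have conj: "(g \<circ> ?s \<circ> inv' g) permutes S" if "g permutes S" for g
    using that s by (intro permutes_compose permutes_inv)
  show ?thesis
  proof (rule transposition_if_conjugate_products[OF fin card_ne_6 permutes[OF s]])
    show "?t \<circ> ?t = id" using comp[OF s s] by (simp add: map_id)
    show "?t \<noteq> id"
      using inject[OF s permutes_id] ne by (simp add: map_id transpose_eq_id_iff)
    show "(?t \<circ> (g \<circ> ?t \<circ> inv' g)) ^^ 6 = id" if g: "g permutes S" for g
    proof -
      obtain g0 where g0: "g0 permutes S" "\<phi> g0 = g" using surject[OF g] by blast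
      have "?t \<circ> (g \<circ> ?t \<circ> inv' g) = \<phi> (?s \<circ> (g0 \<circ> ?s \<circ> inv' g0))"
        using map_conj[OF s g0(1)] comp[OF s conj[OF g0(1)]] g0 by simp
      then have "(?t \<circ> (g \<circ> ?t \<circ> inv' g)) ^^ 6 = \<phi> ((?s \<circ> (g0 \<circ> ?s \<circ> inv' g0)) ^^ 6)"
        using map_funpow[OF permutes_compose[OF conj[OF g0(1)] s]] by simp
      also have "\<dots> = id"
        by (simp only: conj_transpose[OF permutes_bij[OF g0(1)]] transpose_product_pow_6 map_id)
      finally show ?thesis .
    qed
    show "\<exists>g. g permutes S \<and> ?t \<circ> (g \<circ> ?t \<circ> inv' g) \<noteq> (g \<circ> ?t \<circ> inv' g) \<circ> ?t"
      if four: "card S = 4"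
    proof -
      have "card {x, y} = 2" using ne by simp
      then have "S \<noteq> {x, y}" using four by auto
      then obtain z where z: "z \<in> S" "z \<noteq> x" "z \<noteq> y" using x y by blast
      let ?g = "transpose y z"
      have g: "?g permutes S" using y z(1) by (rule permutes_swap_id)
      have s': "?g \<circ> ?s \<circ> inv' ?g = transpose x z"
        using conj_transpose[of ?g x y] z ne by simp
      have "(?s \<circ> transpose x z) x \<noteq> (transpose x z \<circ> ?s) x"
        using z ne by (simp add: transpose_def)
      then have "?s \<circ> (?g \<circ> ?s \<circ> inv' ?g) \<noteq> (?g \<circ> ?s \<circ> inv' ?g) \<circ> ?s"
        unfolding s' by metis
      then have "\<phi> (?s \<circ> (?g \<circ> ?s \<circ> inv' ?g)) \<noteq> \<phi> ((?g \<circ> ?s \<circ> inv' ?g) \<circ> ?s)"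
        using inject s conj[OF g] permutes_compose by blast
      then have "?t \<circ> (\<phi> ?g \<circ> ?t \<circ> inv' (\<phi> ?g)) \<noteq> (\<phi> ?g \<circ> ?t \<circ> inv' (\<phi> ?g)) \<circ> ?t"
        using comp[OF s conj[OF g]] comp[OF conj[OF g] s] map_conj[OF s g] by simp
      then show ?thesis using permutes[OF g] by blast
    qed
  qed
qed

text \<open>Non-commuting transpositions are exactly those with one point in common, and \<open>\<phi>\<close> preserves
  non-commutation.\<close>

lemma transpositions_meet:
  assumes "x \<in> S" "y \<in> S" "z \<in> S" "distinct [x, y, z]"
    and y: "\<phi> (transpose x y) = transpose a b" and z: "\<phi> (transpose x z) = transpose c d"
  shows "{a, b} \<inter> {c, d} \<noteq> {}" and "{a, b} \<noteq> {c, d}"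
proof -
  have sy: "transpose x y permutes S" and sz: "transpose x z permutes S"
    using assms by (auto intro: permutes_swap_id)
  have "(transpose x y \<circ> transpose x z) x \<noteq> (transpose x z \<circ> transpose x y) x"
    using assms(4) by (auto simp: transpose_def)
  then have "transpose x y \<circ> transpose x z \<noteq> transpose x z \<circ> transpose x y" by metis
  then have ne: "transpose a b \<circ> transpose c d \<noteq> transpose c d \<circ> transpose a b"
    using inject[OF permutes_compose[OF sz sy] permutes_compose[OF sy sz]] comp[OF sy sz] comp[OF sz sy] y z
    by simp
  show "{a, b} \<inter> {c, d} \<noteq> {}"
  proof
    assume "{a, b} \<inter> {c, d} = {}"
    then have "transpose a b \<circ> transpose c d = transpose c d \<circ> transpose a b"
      by (auto simp: fun_eq_iff transpose_def)
    with ne show False by simp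
  qed
  show "{a, b} \<noteq> {c, d}"
    using ne by (auto simp: doubleton_eq_iff transpose_commute)
qed

text \<open>Think of transpositions as edges of the complete graph on \<open>S\<close>. The images of the edges at \<open>x\<close>
  meet pairwise, so once two of them are \<open>{c, d}\<close> and \<open>{c, e}\<close>, any other one either contains \<open>c\<close> or
  closes the triangle as \<open>{d, e}\<close>. The latter is impossible, as \<open>(d e) = (c d) (c e) (c d)\<close> is already
  the image of \<open>(y z)\<close>.\<close>

lemma star_image:
  assumes x: "x \<in> S"
  obtains c where "c \<in> S"
    and "\<And>i. i \<in> S \<Longrightarrow> i \<noteq> x \<Longrightarrow> \<exists>f\<in>S. f \<noteq> c \<and> \<phi> (transpose x i) = transpose c f"
proof (cases "\<exists>y\<in>S. y \<noteq> x")
  case False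
  then show thesis using that[OF x] by blast
next
  case True
  then obtain y where y: "y \<in> S" "y \<noteq> x" by auto
  obtain p q where pq: "p \<in> S" "q \<in> S" "p \<noteq> q" "\<phi> (transpose x y) = transpose p q"
    using transposition_image[OF x y(1)] y(2) by blast
  show thesis
  proof (cases "\<exists>z\<in>S. z \<noteq> x \<and> z \<noteq> y")
    case False
    have "\<exists>f\<in>S. f \<noteq> p \<and> \<phi> (transpose x i) = transpose p f" if "i \<in> S" "i \<noteq> x" for i
    proof -
      have "i = y" using False that by auto
      then show ?thesis using pq by auto
    qed
    then show thesis using that[OF pq(1)] by blast
  next
    case True
    then obtain z where z: "z \<in> S" "z \<noteq> x" "z \<noteq> y" by auto
    obtain p' q' where pq': "p' \<in> S" "q' \<in> S" "p' \<noteq> q'" "\<phi> (transpose x z) = transpose p' q'"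
      using transposition_image[OF x z(1)] z(2) by blast
    have "{p, q} \<inter> {p', q'} \<noteq> {}" and "{p, q} \<noteq> {p', q'}"
      using transpositions_meet[OF x y(1) z(1) _ pq(4) pq'(4)] y z by auto
    then obtain c d e where cde: "c \<in> S" "d \<in> S" "e \<in> S" "distinct [c, d, e]"
      and d: "\<phi> (transpose x y) = transpose c d" and e: "\<phi> (transpose x z) = transpose c e"
    proof -
      consider "p = p'" "q \<noteq> q'" | "p = q'" "q \<noteq> p'" | "q = p'" "p \<noteq> q'" | "q = q'" "p \<noteq> p'"
        using \<open>{p, q} \<inter> {p', q'} \<noteq> {}\<close> \<open>{p, q} \<noteq> {p', q'}\<close> by (auto simp: doubleton_eq_iff)
      then show thesis
      proof cases
        case 1 then show ?thesis using that[of p q q'] pq pq' by auto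
      next
        case 2 then show ?thesis using that[of p q p'] pq pq' by (auto simp: transpose_commute)
      next
        case 3 then show ?thesis using that[of q p q'] pq pq' by (auto simp: transpose_commute)
      next
        case 4 then show ?thesis using that[of q p p'] pq pq' by (auto simp: transpose_commute)
      qed
    qed
    have sy: "transpose x y permutes S" and sz: "transpose x z permutes S"
      and yz: "transpose y z permutes S"
      using x y z by (auto intro: permutes_swap_id)
    have "transpose y z = transpose x y \<circ> transpose x z \<circ> transpose x y"
      using y z by (auto simp: fun_eq_iff transpose_def)
    then have "\<phi> (transpose y z) = transpose c d \<circ> transpose c e \<circ> transpose c d"
      using comp[OF permutes_compose[OF sz sy] sy] comp[OF sy sz] d e by simp
    also have "\<dots> = transpose d e"
      using cde by (auto simp: fun_eq_iff transpose_def)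
    finally have de: "\<phi> (transpose y z) = transpose d e" .
    have "\<exists>f\<in>S. f \<noteq> c \<and> \<phi> (transpose x i) = transpose c f" if i: "i \<in> S" "i \<noteq> x" for i
    proof (cases "i = y \<or> i = z")
      case True
      then show ?thesis using cde d e by auto
    next
      case False
      obtain a b where ab: "a \<in> S" "b \<in> S" "a \<noteq> b" "\<phi> (transpose x i) = transpose a b"
        using transposition_image[OF x i(1)] i(2) by blast
      have "{c, d} \<inter> {a, b} \<noteq> {}"
        using transpositions_meet(1)[OF x y(1) i(1) _ d ab(4)] y i False by auto
      moreover have "{c, e} \<inter> {a, b} \<noteq> {}"
        using transpositions_meet(1)[OF x z(1) i(1) _ e ab(4)] z i False by auto
      moreover have "{a, b} \<noteq> {d, e}"
      proof
        assume "{a, b} = {d, e}"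
        then have "\<phi> (transpose x i) = \<phi> (transpose y z)"
          using ab de by (auto simp: doubleton_eq_iff transpose_commute)
        then have "transpose x i = transpose y z"
          using inject[OF permutes_swap_id[OF x i(1)] yz] by simp
        then have "transpose x i x = transpose y z x" by simp
        then show False using i y z by (simp add: transpose_def)
      qed
      ultimately have "a = c \<or> b = c" using cde by auto
      then show ?thesis
        using ab by (auto simp: transpose_commute)
    qed
    then show thesis using that[OF cde(1)] by blast
  qed
qed

text \<open>If the image of \<open>(x i)\<close> is \<open>(c (f i))\<close>, the candidate for the conjugating permutation is forced:
  \<open>g\<close> sends \<open>x\<close> to \<open>c\<close> and every other \<open>i\<close> to \<open>f i\<close>. It agrees with \<open>\<phi>\<close> on the generators \<open>(x i)\<close>.\<close>

theorem inner: "\<exists>g. g permutes S \<and> (\<forall>p. p permutes S \<longrightarrow> \<phi> p = g \<circ> p \<circ> inv' g)"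
proof (cases "S = {}")
  case True
  then show ?thesis by (auto simp: map_id)
next
  case False
  then obtain x where x: "x \<in> S" by auto
  obtain c where c: "c \<in> S"
    and star: "\<And>i. i \<in> S \<Longrightarrow> i \<noteq> x \<Longrightarrow> \<exists>f\<in>S. f \<noteq> c \<and> \<phi> (transpose x i) = transpose c f"
    using star_image[OF x] by blast
  from star obtain f where f: "\<And>i. i \<in> S \<Longrightarrow> i \<noteq> x \<Longrightarrow> f i \<in> S \<and> f i \<noteq> c \<and> \<phi> (transpose x i) = transpose c (f i)"
    by metis
  define g where "g i = (if i = x then c else if i \<in> S then f i else i)" for i
  have "inj_on g S"
  proof (rule inj_onI)
    fix i j assume ij: "i \<in> S" "j \<in> S" "g i = g j"
    show "i = j"
    proof (cases "i = x \<or> j = x")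
      case True
      then show ?thesis using ij f by (metis g_def)
    next
      case False
      then have "\<phi> (transpose x i) = \<phi> (transpose x j)"
        using ij f[of i] f[of j] by (simp add: g_def)
      then have "transpose x i = transpose x j"
        using inject[OF permutes_swap_id[OF x ij(1)] permutes_swap_id[OF x ij(2)]] by simp
      then show ?thesis by (metis transpose_apply_first)
    qed
  qed
  moreover have "g ` S \<subseteq> S" using c f by (auto simp: g_def)
  ultimately have "bij_betw g S S"
    using fin by (simp add: bij_betw_def endo_inj_surj)
  then have g: "g permutes S"
    by (rule bij_imp_permutes) (use x in \<open>auto simp: g_def\<close>)
  have "\<phi> p = g \<circ> p \<circ> inv' g" if "p permutes S" for p
    using that fin x
  proof (rule permutes_split_star)
    show "\<phi> id = g \<circ> id \<circ> inv' g" using permutes_inv_o(1)[OF g] by (simp add: map_id)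
    fix i q assume i: "i \<in> S" "i \<noteq> x" and q: "q permutes S" and IH: "\<phi> q = g \<circ> q \<circ> inv' g"
    have "\<phi> (transpose x i) = g \<circ> transpose x i \<circ> inv' g"
      using f[OF i] i conj_transpose[OF permutes_bij[OF g], of x i] by (simp add: g_def)
    then have "\<phi> (transpose x i \<circ> q) = (g \<circ> transpose x i \<circ> inv' g) \<circ> (g \<circ> q \<circ> inv' g)"
      using comp[OF permutes_swap_id[OF x i(1)] q] IH by simp
    also have "\<dots> = g \<circ> (transpose x i \<circ> q) \<circ> inv' g"
      using permutes_inverses(2)[OF g] by (simp add: fun_eq_iff)
    finally show "\<phi> (transpose x i \<circ> q) = g \<circ> (transpose x i \<circ> q) \<circ> inv' g" .
  qed
  with g show ?thesis by blast
qed

end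

corollary sym_group_automorphism_inner:
  assumes "n \<noteq> 6" and "\<phi> \<in> iso (sym_group n) (sym_group n)"
  shows "\<exists>g \<in> carrier (sym_group n). \<forall>x \<in> carrier (sym_group n).
    \<phi> x = g \<otimes>\<^bsub>sym_group n\<^esub> x \<otimes>\<^bsub>sym_group n\<^esub> inv\<^bsub>sym_group n\<^esub> g"
proof -
  interpret symmetric_automorphism "{1..n}" \<phi>
    using assms by unfold_locales (auto simp: iso_def hom_def sym_group_def)
  from inner show ?thesis
    by (auto simp: sym_group_carrier sym_group_mult)
qed

section \<open>Families with equal multiplicities\<close>

text \<open>Fibres of equal size can be matched with each other, and they together form a bijection. Applied
  over each conjugacy class, this makes the type a complete invariant of a family of characters up to
  reordering.\<close>

lemma reindexing_iff_equal_fibre_cards: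
  assumes fin: "finite A" and f: "f ` A \<subseteq> B" and f': "f' ` A \<subseteq> B"
  shows "(\<exists>b. bij_betw b A A \<and> (\<forall>i\<in>A. f' (b i) = f i)) \<longleftrightarrow>
    (\<forall>x\<in>B. card {j\<in>A. f j = x} = card {j\<in>A. f' j = x})" (is "?L \<longleftrightarrow> ?R")
proof
  assume ?L
  then obtain b where b: "bij_betw b A A" "\<And>i. i \<in> A \<Longrightarrow> f' (b i) = f i" by blast
  show ?R
  proof
    fix x
    have "bij_betw b {j\<in>A. f j = x} {j\<in>A. f' j = x}"
      using b unfolding bij_betw_def inj_on_def by (auto simp: image_iff set_eq_iff) metis
    then show "card {j\<in>A. f j = x} = card {j\<in>A. f' j = x}" by (rule bij_betw_same_card)
  qed
next
  assume R: ?R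
  have count: "count (image_mset k (mset_set A)) x = card {j\<in>A. k j = x}" for k :: "'a \<Rightarrow> 'b" and x
    using fin by (simp add: count_image_mset vimage_def Int_def conj_commute)
  have "image_mset f (mset_set A) = image_mset f' (mset_set A)"
  proof (rule multiset_eqI)
    fix x
    show "count (image_mset f (mset_set A)) x = count (image_mset f' (mset_set A)) x"
    proof (cases "x \<in> B")
      case True
      then show ?thesis using R by (simp add: count)
    next
      case False
      then have "{j\<in>A. f j = x} = {}" "{j\<in>A. f' j = x} = {}" using f f' by auto
      then show ?thesis by (simp only: count)
    qed
  qed
  then obtain p where "p permutes A" "\<forall>x\<in>A. f x = f' (p x)"
    using image_mset_eq_implies_permutes[OF fin] by blast
  then show ?L using permutes_imp_bij by metis
qed

section \<open>Centralizers and characters under conjugation\<close>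

context group
begin

lemma conj_conj:
  assumes "g \<in> carrier G" "h \<in> carrier G" "x \<in> carrier G"
  shows "g \<otimes> (h \<otimes> x \<otimes> inv h) \<otimes> inv g = (g \<otimes> h) \<otimes> x \<otimes> inv (g \<otimes> h)"
  using assms by (simp add: m_assoc inv_mult_group)

lemma inv_conj_conj:
  assumes "h \<in> carrier G" "x \<in> carrier G"
  shows "inv h \<otimes> (h \<otimes> x \<otimes> inv h) \<otimes> h = x" "h \<otimes> (inv h \<otimes> x \<otimes> h) \<otimes> inv h = x"
  using conj_conj[of "inv h" h x] conj_conj[of h "inv h" x] assms by simp_all

lemma subgroup_centralizer:
  assumes x: "x \<in> carrier G"
  shows "subgroup (centralizer G x) G"
proof (rule subgroupI)
  show "centralizer G x \<noteq> {}" using x by (auto simp: centralizer_def intro: exI[of _ \<one>])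
  fix a assume a: "a \<in> centralizer G x"
  then show "inv a \<in> centralizer G x"
    using x by (auto simp: centralizer_def) (metis inv_closed inv_solve_left inv_solve_right m_assoc m_closed)
  fix b assume "b \<in> centralizer G x"
  then show "a \<otimes> b \<in> centralizer G x"
    using a x by (auto simp: centralizer_def) (metis m_assoc)
qed (auto simp: centralizer_def)

lemma centralizer_iff_conj_fixes:
  assumes "x \<in> carrier G"
  shows "z \<in> centralizer G x \<longleftrightarrow> z \<in> carrier G \<and> z \<otimes> x \<otimes> inv z = x"
  using assms by (auto simp: centralizer_def m_assoc) (metis inv_closed inv_solve_right m_assoc m_closed)+

lemma conj_in_centralizer:
  assumes h: "h \<in> carrier G" and x: "x \<in> carrier G" and y: "y \<in> centralizer G x"
  shows "h \<otimes> y \<otimes> inv h \<in> centralizer G (h \<otimes> x \<otimes> inv h)"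
proof -
  have y': "y \<in> carrier G" "y \<otimes> x = x \<otimes> y" using y by (auto simp: centralizer_def)
  have mult: "(h \<otimes> a \<otimes> inv h) \<otimes> (h \<otimes> b \<otimes> inv h) = h \<otimes> (a \<otimes> b) \<otimes> inv h"
    if "a \<in> carrier G" "b \<in> carrier G" for a b
    using that h by (metis inv_closed inv_solve_left m_assoc m_closed)
  show ?thesis using h x y' by (simp add: centralizer_def mult)
qed

text \<open>The values of a character lie in a commutative group, so it is constant on the conjugacy classes
  of its domain. This removes the ambiguity in the choice of conjugating elements.\<close>

lemma character_conj:
  assumes F: "field F" and H: "subgroup H G" and f: "f \<in> characters F G H"
    and z: "z \<in> H" and y: "y \<in> H"
  shows "f (z \<otimes> y \<otimes> inv z) = f y"
proof -
  interpret F: field F by (fact F)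
  interpret H: subgroup H G by (fact H)
  have mult: "f (a \<otimes> b) = f a \<otimes>\<^bsub>F\<^esub> f b" if "a \<in> H" "b \<in> H" for a b
    using f that by (auto simp: characters_def hom_def)
  have val: "f a \<in> carrier F" "f a \<noteq> \<zero>\<^bsub>F\<^esub>" if "a \<in> H" for a
    using f that by (auto simp: characters_def hom_def)
  have in_H: "z \<otimes> y \<otimes> inv z \<in> H" using z y by simp
  have "f z \<otimes>\<^bsub>F\<^esub> f (z \<otimes> y \<otimes> inv z) = f (z \<otimes> y \<otimes> inv z \<otimes> z)"
    using mult[OF in_H z] val in_H z by (simp add: F.m_comm)
  also have "z \<otimes> y \<otimes> inv z \<otimes> z = z \<otimes> y"
    using z y by (simp add: m_assoc)
  also have "f (z \<otimes> y) = f z \<otimes>\<^bsub>F\<^esub> f y" by (rule mult[OF z y])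
  finally show ?thesis
    using F.m_lcancel[OF val(2)[OF z] val(1)[OF z] val(1)[OF in_H] val(1)[OF y]] by simp
qed

text \<open>Conjugation by \<open>h\<close> maps the centralizer of \<open>x\<close> onto that of \<open>h x h\<^sup>-\<^sup>1\<close>, and this is \<open>f\<close>
  carried along. It is restricted because members of \<open>characters\<close> are extensional.\<close>

definition conj_character :: "'a \<Rightarrow> 'a \<Rightarrow> ('a \<Rightarrow> 'f) \<Rightarrow> 'a \<Rightarrow> 'f" where
  "conj_character h x f = (\<lambda>y \<in> centralizer G (h \<otimes> x \<otimes> inv h). f (inv h \<otimes> y \<otimes> h))"

lemma inv_conj_in_centralizer:
  assumes h: "h \<in> carrier G" and x: "x \<in> carrier G" and y: "y \<in> centralizer G (h \<otimes> x \<otimes> inv h)"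
  shows "inv h \<otimes> y \<otimes> h \<in> centralizer G x"
  using conj_in_centralizer[of "inv h" "h \<otimes> x \<otimes> inv h" y] assms inv_conj_conj[OF h x] by simp

lemma conj_character:
  assumes h: "h \<in> carrier G" and x: "x \<in> carrier G" and f: "f \<in> characters F G (centralizer G x)"
  shows "conj_character h x f \<in> characters F G (centralizer G (h \<otimes> x \<otimes> inv h))"
proof -
  let ?Z = "centralizer G (h \<otimes> x \<otimes> inv h)"
  have Z: "subgroup ?Z G" using h x by (intro subgroup_centralizer) simp
  have carr: "y \<in> carrier G" if "y \<in> ?Z" for y using that by (simp add: centralizer_def)
  have "inv h \<otimes> (a \<otimes> b) \<otimes> h = (inv h \<otimes> a \<otimes> h) \<otimes> (inv h \<otimes> b \<otimes> h)"
    if "a \<in> carrier G" "b \<in> carrier G" for a b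
    using that h by (metis inv_closed inv_solve_left m_assoc m_closed inv_inv)
  then show ?thesis
    using f inv_conj_in_centralizer[OF h x] subgroup.m_closed[OF Z] carr
    by (auto simp: characters_def hom_def conj_character_def Pi_iff)
qed

lemma conj_image_conjugacy_class:
  assumes g: "g \<in> carrier G" and C: "C \<in> conjugacy_classes G"
  shows "(\<lambda>x. g \<otimes> x \<otimes> inv g) ` C = C"
proof -
  obtain a where a: "a \<in> carrier G" "C = conjugacy_class G a"
    using C by (auto simp: conjugacy_classes_def)
  have sub: "(\<lambda>x. k \<otimes> x \<otimes> inv k) ` C \<subseteq> C" if k: "k \<in> carrier G" for k
  proof clarify
    fix x assume "x \<in> C"
    then obtain m where m: "m \<in> carrier G" "x = m \<otimes> a \<otimes> inv m"
      using a by (auto simp: conjugacy_class_def)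
    then show "k \<otimes> x \<otimes> inv k \<in> C"
      using a k conj_conj[OF k m(1) a(1)] by (auto simp: conjugacy_class_def)
  qed
  have "x \<in> (\<lambda>x. g \<otimes> x \<otimes> inv g) ` C" if "x \<in> C" for x
  proof
    have "x \<in> carrier G" using that a by (auto simp: conjugacy_class_def)
    then show "x = g \<otimes> (inv g \<otimes> x \<otimes> g) \<otimes> inv g" using inv_conj_conj(2)[OF g] by simp
    show "inv g \<otimes> x \<otimes> g \<in> C" using sub[of "inv g"] g that by auto
  qed
  with sub[OF g] show ?thesis by blast
qed

lemma class_representatives_conjugate:
  assumes u: "u \<in> class_representative_maps G" "v \<in> class_representative_maps G"
    and C: "C \<in> conjugacy_classes G"
  shows "u C \<in> carrier G" and "\<exists>h \<in> carrier G. h \<otimes> u C \<otimes> inv h = v C"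
proof -
  obtain a where a: "a \<in> carrier G" "C = conjugacy_class G a"
    using C by (auto simp: conjugacy_classes_def)
  have "u C \<in> C" "v C \<in> C" using u C by (auto simp: class_representative_maps_def)
  then obtain m k where m: "m \<in> carrier G" "u C = m \<otimes> a \<otimes> inv m"
    and k: "k \<in> carrier G" "v C = k \<otimes> a \<otimes> inv k"
    using a by (auto simp: conjugacy_class_def)
  show "u C \<in> carrier G" using m a by simp
  have "(k \<otimes> inv m) \<otimes> (m \<otimes> a \<otimes> inv m) \<otimes> inv (k \<otimes> inv m) = (k \<otimes> inv m \<otimes> m) \<otimes> a \<otimes> inv (k \<otimes> inv m \<otimes> m)"
    using m(1) k(1) a(1) by (intro conj_conj) auto
  also have "k \<otimes> inv m \<otimes> m = k" using m(1) k(1) by (simp add: m_assoc)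
  finally show "\<exists>h \<in> carrier G. h \<otimes> u C \<otimes> inv h = v C" using m k by auto
qed

end

section \<open>Ramification systems over a fixed choice of class representatives\<close>

text \<open>The characters of a system with representatives \<open>u\<close>, read over the representatives
  \<open>h C (u C) (h C)\<^sup>-\<^sup>1\<close> instead.\<close>

definition transport_characters ::
    "'a monoid \<Rightarrow> ('a set \<Rightarrow> nat) \<Rightarrow> (('a set \<Rightarrow> nat) \<Rightarrow> 'a set \<Rightarrow> 'i set) \<Rightarrow> ('a set \<Rightarrow> 'a) \<Rightarrow>
     ('a set \<Rightarrow> 'a) \<Rightarrow> ('a set \<Rightarrow> 'i \<Rightarrow> 'a \<Rightarrow> 'f) \<Rightarrow> 'a set \<Rightarrow> 'i \<Rightarrow> 'a \<Rightarrow> 'f" where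
  "transport_characters G r I h u \<chi> =
     (\<lambda>C \<in> ram_support G r. \<lambda>i \<in> I r C. group.conj_character G (h C) (u C) (\<chi> C i))"

lemma restrict_eq_iff: "restrict f A = restrict g A \<longleftrightarrow> (\<forall>x\<in>A. f x = g x)"
  by (metis restrict_apply restrict_ext)

lemma RSC_type_eq_iff:
  assumes I: "index_sets G r I" and \<xi>: "character_enumeration F G r u \<xi>"
    and R: "is_RSC F I (G, r, \<chi>, u)" "is_RSC F I (G, r, \<chi>', u)"
  shows "RSC_type F I \<xi> (G, r, \<chi>, u) = RSC_type F I \<xi> (G, r, \<chi>', u) \<longleftrightarrow>
    (\<forall>C\<in>ram_support G r. \<exists>b. bij_betw b (I r C) (I r C) \<and> (\<forall>i\<in>I r C. \<chi>' C (b i) = \<chi> C i))"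
proof -
  have "RSC_type F I \<xi> (G, r, \<chi>, u) = RSC_type F I \<xi> (G, r, \<chi>', u) \<longleftrightarrow>
    (\<forall>C\<in>ram_support G r. \<forall>k \<in> {1..num_characters F G u C}.
      card {j \<in> I r C. \<chi> C j = \<xi> C k} = card {j \<in> I r C. \<chi>' C j = \<xi> C k})"
    by (simp add: RSC_type_def restrict_eq_iff atLeastLessThanSuc_atLeastAtMost del: upt_Suc)
  also have "\<dots> \<longleftrightarrow> (\<forall>C\<in>ram_support G r.
      \<exists>b. bij_betw b (I r C) (I r C) \<and> (\<forall>i\<in>I r C. \<chi>' C (b i) = \<chi> C i))"
  proof (rule ball_cong[OF refl])
    fix C assume C: "C \<in> ram_support G r"
    let ?Ch = "characters F G (centralizer G (u C))"
    have B: "\<xi> C ` {1..num_characters F G u C} = ?Ch"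
      using \<xi> C by (auto simp: character_enumeration_def bij_betw_def)
    have fin: "finite (I r C)" using I C by (auto simp: index_sets_def ram_support_def)
    have "\<chi> C ` I r C \<subseteq> ?Ch" "\<chi>' C ` I r C \<subseteq> ?Ch"
      using R C unfolding is_RSC_def by (auto simp: PiE_iff)
    from reindexing_iff_equal_fibre_cards[OF fin this]
    show "(\<forall>k \<in> {1..num_characters F G u C}.
        card {j \<in> I r C. \<chi> C j = \<xi> C k} = card {j \<in> I r C. \<chi>' C j = \<xi> C k}) \<longleftrightarrow>
      (\<exists>b. bij_betw b (I r C) (I r C) \<and> (\<forall>i\<in>I r C. \<chi>' C (b i) = \<chi> C i))"
      unfolding B[symmetric] by simp
  qed
  finally show ?thesis .
qed

lemma transport_RSC:
  fixes G :: "'a monoid" (structure)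
  assumes R: "is_RSC F I (G, r, \<chi>, u)" and v: "v \<in> class_representative_maps G"
    and h: "\<And>C. C \<in> conjugacy_classes G \<Longrightarrow>
      h C \<in> carrier G \<and> h C \<otimes> u C \<otimes> inv h C = v C"
  shows "is_RSC F I (G, r, transport_characters G r I h u \<chi>, v)"
proof -
  interpret group G using R by (simp add: is_RSC_def)
  have u: "u \<in> class_representative_maps G" using R by (simp add: is_RSC_def)
  have "conj_character (h C) (u C) (\<chi> C i) \<in> characters F G (centralizer G (v C))"
    if C: "C \<in> ram_support G r" and i: "i \<in> I r C" for C i
  proof -
    have C': "C \<in> conjugacy_classes G" using C by (simp add: ram_support_def)
    have "\<chi> C i \<in> characters F G (centralizer G (u C))"
      using R C i unfolding is_RSC_def by (auto simp: PiE_iff)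
    then show ?thesis
      using conj_character[of "h C" "u C" "\<chi> C i" F] h[OF C']
        class_representatives_conjugate(1)[OF u v C'] by simp
  qed
  then show ?thesis
    using R v by (auto simp: is_RSC_def transport_characters_def)
qed

text \<open>Two elements conjugating \<open>u C\<close> to \<open>v C\<close> differ by an element \<open>z\<close> of the centralizer of \<open>v C\<close>. An
  isomorphism is conjugation by some \<open>g\<close>, so together with its conjugating element \<open>k C\<close> it acts on
  the centralizer of \<open>u C\<close> as conjugation by \<open>g k C = z h C\<close>. Conjugation by \<open>z\<close> does not change characters,
  hence every isomorphism relates characters in the same way as the transport along \<open>h\<close>, up to a
  reindexing over each class.\<close>

lemma RSC_isomorphic_iff_RSC_type_transport_eq:
  fixes G :: "'a monoid" (structure)
  assumes inner: "\<And>\<phi>. \<phi> \<in> iso G G \<Longrightarrow> \<exists>g \<in> carrier G. \<forall>x \<in> carrier G.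
      \<phi> x = g \<otimes> x \<otimes> inv g"
    and F: "field F" and I: "index_sets G r I" and \<xi>: "character_enumeration F G r v \<xi>"
    and R: "is_RSC F I (G, r, \<chi>, u)" and R': "is_RSC F I (G, r, \<chi>', v)"
    and h: "\<And>C. C \<in> conjugacy_classes G \<Longrightarrow>
      h C \<in> carrier G \<and> h C \<otimes> u C \<otimes> inv h C = v C"
  shows "RSC_isomorphic I I (G, r, \<chi>, u) (G, r, \<chi>', v) \<longleftrightarrow>
    RSC_type F I \<xi> (G, r, transport_characters G r I h u \<chi>, v) = RSC_type F I \<xi> (G, r, \<chi>', v)"
proof -
  interpret group G using R by (simp add: is_RSC_def)
  have u: "u \<in> class_representative_maps G" and v: "v \<in> class_representative_maps G"
    using R R' by (simp_all add: is_RSC_def)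
  have uC: "u C \<in> carrier G" and vC: "v C \<in> carrier G" and hC: "h C \<in> carrier G"
    and huv: "h C \<otimes> u C \<otimes> inv h C = v C" if "C \<in> conjugacy_classes G" for C
    using class_representatives_conjugate(1)[OF u v that]
      class_representatives_conjugate(1)[OF v u that] h[OF that] by auto
  have supp: "C \<in> conjugacy_classes G" if "C \<in> ram_support G r" for C
    using that by (simp add: ram_support_def)
  have Zcarr: "x \<in> carrier G" if "x \<in> centralizer G y" for x y
    using that by (simp add: centralizer_def)
  have \<chi>': "\<chi>' C i \<in> characters F G (centralizer G (v C))"
    if "C \<in> ram_support G r" "i \<in> I r C" for C i
    using R' that unfolding is_RSC_def by (auto simp: PiE_iff)
  have trans: "transport_characters G r I h u \<chi> C i = conj_character (h C) (u C) (\<chi> C i)"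
    if "C \<in> ram_support G r" "i \<in> I r C" for C i
    using that by (simp add: transport_characters_def)
  have transport: "is_RSC F I (G, r, transport_characters G r I h u \<chi>, v)"
    using R v h by (rule transport_RSC)
  show ?thesis
    unfolding RSC_type_eq_iff[OF I \<xi> transport R']
  proof
    assume "RSC_isomorphic I I (G, r, \<chi>, u) (G, r, \<chi>', v)"
    then obtain \<phi> k where \<phi>: "\<phi> \<in> iso G G" and k: "k \<in> conjugacy_classes G \<rightarrow> carrier G"
      and kv: "\<And>C. C \<in> conjugacy_classes G \<Longrightarrow> \<phi> (k C \<otimes> u C \<otimes> inv k C) = v (\<phi> ` C)"
      and iso: "\<And>C. C \<in> ram_support G r \<Longrightarrow> \<exists>b. bij_betw b (I r C) (I r (\<phi> ` C)) \<and>
          (\<forall>x\<in>centralizer G (u C). \<forall>i\<in>I r C.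
             \<chi>' (\<phi> ` C) (b i) (\<phi> (k C \<otimes> x \<otimes> inv k C)) = \<chi> C i x)"
      by (auto simp: RSC_isomorphic_def)
    obtain g where g: "g \<in> carrier G" and \<phi>g: "\<And>x. x \<in> carrier G \<Longrightarrow> \<phi> x = g \<otimes> x \<otimes> inv g"
      using inner[OF \<phi>] by auto
    show "\<forall>C\<in>ram_support G r. \<exists>b. bij_betw b (I r C) (I r C) \<and>
        (\<forall>i\<in>I r C. \<chi>' C (b i) = transport_characters G r I h u \<chi> C i)"
    proof
      fix C assume C: "C \<in> ram_support G r"
      note C' = supp[OF C]
      have kC: "k C \<in> carrier G" using k C' by auto
      have "C \<subseteq> carrier G" using C' by (auto simp: conjugacy_classes_def conjugacy_class_def)
      then have "\<phi> ` C = (\<lambda>x. g \<otimes> x \<otimes> inv g) ` C" using \<phi>g by (intro image_cong) auto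
      then have \<phi>C: "\<phi> ` C = C" using conj_image_conjugacy_class[OF g C'] by simp
      obtain b where b: "bij_betw b (I r C) (I r C)"
        and b\<chi>: "\<And>x i. x \<in> centralizer G (u C) \<Longrightarrow> i \<in> I r C \<Longrightarrow>
            \<chi>' C (b i) (\<phi> (k C \<otimes> x \<otimes> inv k C)) = \<chi> C i x"
        using iso[OF C] \<phi>C by auto
      define z where "z = g \<otimes> k C \<otimes> inv h C"
      have z: "z \<in> carrier G" using g kC hC[OF C'] by (simp add: z_def)
      have zh: "z \<otimes> h C = g \<otimes> k C" using g kC hC[OF C'] by (simp add: z_def m_assoc)
      have conj_z: "\<phi> (k C \<otimes> x \<otimes> inv k C) = z \<otimes> (h C \<otimes> x \<otimes> inv h C) \<otimes> inv z"
        if "x \<in> carrier G" for x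
        using conj_conj[OF g kC that] conj_conj[OF z hC[OF C'] that] \<phi>g[of "k C \<otimes> x \<otimes> inv k C"]
          kC that by (simp add: zh)
      have "z \<otimes> v C \<otimes> inv z = v C"
        using conj_z[OF uC[OF C']] kv[OF C'] huv[OF C'] \<phi>C by simp
      then have zZ: "z \<in> centralizer G (v C)"
        using centralizer_iff_conj_fixes[OF vC[OF C']] z by simp
      have "\<chi>' C (b i) = conj_character (h C) (u C) (\<chi> C i)" if i: "i \<in> I r C" for i
      proof (rule extensionalityI)
        have bi: "b i \<in> I r C" using b i by (auto simp: bij_betw_def)
        show "\<chi>' C (b i) \<in> extensional (centralizer G (v C))"
          using \<chi>'[OF C bi] by (simp add: characters_def)
        show "conj_character (h C) (u C) (\<chi> C i) \<in> extensional (centralizer G (v C))"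
          by (simp add: conj_character_def huv[OF C'])
        fix y assume y: "y \<in> centralizer G (v C)"
        let ?x = "inv h C \<otimes> y \<otimes> h C"
        have x: "?x \<in> centralizer G (u C)"
          using inv_conj_in_centralizer[OF hC[OF C'] uC[OF C']] y huv[OF C'] by simp
        have "\<chi> C i ?x = \<chi>' C (b i) (z \<otimes> y \<otimes> inv z)"
          using b\<chi>[OF x i] conj_z[OF Zcarr[OF x]] inv_conj_conj(2)[OF hC[OF C'] Zcarr[OF y]] by simp
        also have "\<dots> = \<chi>' C (b i) y"
          by (rule character_conj[OF F subgroup_centralizer[OF vC[OF C']] \<chi>'[OF C bi] zZ y])
        finally show "\<chi>' C (b i) y = conj_character (h C) (u C) (\<chi> C i) y"
          using y by (simp add: conj_character_def huv[OF C'])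
      qed
      then show "\<exists>b. bij_betw b (I r C) (I r C) \<and>
          (\<forall>i\<in>I r C. \<chi>' C (b i) = transport_characters G r I h u \<chi> C i)"
        using b trans[OF C] by auto
    qed
  next
    assume reindex: "\<forall>C\<in>ram_support G r. \<exists>b. bij_betw b (I r C) (I r C) \<and>
        (\<forall>i\<in>I r C. \<chi>' C (b i) = transport_characters G r I h u \<chi> C i)"
    have "\<exists>b. bij_betw b (I r C) (I r C) \<and> (\<forall>x\<in>centralizer G (u C). \<forall>i\<in>I r C.
        \<chi>' C (b i) (h C \<otimes> x \<otimes> inv h C) = \<chi> C i x)" if C: "C \<in> ram_support G r" for C
    proof -
      note C' = supp[OF C]
      obtain b where b: "bij_betw b (I r C) (I r C)"
        and bt: "\<And>i. i \<in> I r C \<Longrightarrow> \<chi>' C (b i) = transport_characters G r I h u \<chi> C i"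
        using reindex C by blast
      have "\<chi>' C (b i) (h C \<otimes> x \<otimes> inv h C) = \<chi> C i x"
        if "x \<in> centralizer G (u C)" "i \<in> I r C" for x i
        using conj_in_centralizer[OF hC[OF C'] uC[OF C'] that(1)]
          inv_conj_conj(1)[OF hC[OF C'] Zcarr[OF that(1)]]
        by (simp add: bt[OF that(2)] trans[OF C that(2)] conj_character_def)
      with b show ?thesis by blast
    qed
    then show "RSC_isomorphic I I (G, r, \<chi>, u) (G, r, \<chi>', v)"
      unfolding RSC_isomorphic_def
      using hC huv by (auto intro!: bexI[of _ "\<lambda>x. x"] bexI[of _ h] simp: iso_set_refl)
  qed
qed

text \<open>Transporting \<open>R\<close> to the representatives \<open>v\<close> yields a system \<open>T\<close> such that \<open>R\<close> is isomorphic to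
  exactly those members of \<open>\<Omega>bar\<close> that have the type of \<open>T\<close>, and there is one such member.\<close>

theorem representatives_if_automorphisms_inner:
  fixes G :: "'a monoid" (structure)
  assumes inner: "\<And>\<phi>. \<phi> \<in> iso G G \<Longrightarrow> \<exists>g \<in> carrier G. \<forall>x \<in> carrier G.
      \<phi> x = g \<otimes> x \<otimes> inv g"
    and F: "field F" and I: "index_sets G r I"
    and v: "v \<in> class_representative_maps G" and \<xi>: "character_enumeration F G r v \<xi>"
    and sub: "\<Omega>bar \<subseteq> Omega_at F I G r v"
    and types: "\<forall>t \<in> RSC_type F I \<xi> ` Omega_at F I G r v. \<exists>!R. R \<in> \<Omega>bar \<and> RSC_type F I \<xi> R = t"
    and R: "R \<in> Omega F I G r"
  shows "\<exists>!R'. R' \<in> \<Omega>bar \<and> RSC_isomorphic I I R R'"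
proof -
  obtain \<chi> u where R_eq: "R = (G, r, \<chi>, u)" and RSC: "is_RSC F I (G, r, \<chi>, u)"
    using R by (auto simp: Omega_def)
  interpret group G using RSC by (simp add: is_RSC_def)
  have u: "u \<in> class_representative_maps G" using RSC by (simp add: is_RSC_def)
  obtain h where h: "\<And>C. C \<in> conjugacy_classes G \<Longrightarrow>
      h C \<in> carrier G \<and> h C \<otimes> u C \<otimes> inv h C = v C"
    using class_representatives_conjugate(2)[OF u v] by metis
  define T where "T = (G, r, transport_characters G r I h u \<chi>, v)"
  have T: "T \<in> Omega_at F I G r v"
    using transport_RSC[OF RSC v h] by (auto simp: T_def Omega_at_def)
  have "R' \<in> \<Omega>bar \<and> RSC_isomorphic I I R R' \<longleftrightarrow>
      R' \<in> \<Omega>bar \<and> RSC_type F I \<xi> R' = RSC_type F I \<xi> T" for R'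
  proof (rule conj_cong[OF refl])
    assume "R' \<in> \<Omega>bar"
    then obtain \<chi>' where "R' = (G, r, \<chi>', v)" "is_RSC F I (G, r, \<chi>', v)"
      using sub by (auto simp: Omega_at_def)
    then show "RSC_isomorphic I I R R' \<longleftrightarrow> RSC_type F I \<xi> R' = RSC_type F I \<xi> T"
      using RSC_isomorphic_iff_RSC_type_transport_eq[OF inner F I \<xi> RSC _ h]
      by (auto simp: R_eq T_def)
  qed
  with types T show ?thesis by simp
qed

section \<open>Ramification systems of symmetric groups\<close>

theorem theorem2p24:
  fixes n :: nat
    and F :: "('f, 'k) ring_scheme"
    and I :: "((nat \<Rightarrow> nat) set \<Rightarrow> nat) \<Rightarrow> (nat \<Rightarrow> nat) set \<Rightarrow> 'i set"
    and r :: "(nat \<Rightarrow> nat) set \<Rightarrow> nat"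
    and u\<^sub>0 :: "(nat \<Rightarrow> nat) set \<Rightarrow> nat \<Rightarrow> nat"
    and \<xi> :: "(nat \<Rightarrow> nat) set \<Rightarrow> nat \<Rightarrow> (nat \<Rightarrow> nat) \<Rightarrow> 'f"
    and \<zeta> :: 'f
    and \<Omega>bar :: "(nat \<Rightarrow> nat, 'f, 'i) quadruple set"
  assumes "n \<ge> 1" and "n \<noteq> 6"
    and "field F"
    and "\<zeta> \<in> carrier (Multiplicative_Group.mult_of F)" and "group.ord (Multiplicative_Group.mult_of F) \<zeta> = n"
    and "r \<in> ramifications (sym_group n)"
    and "index_sets (sym_group n) r I"
    and "u\<^sub>0 \<in> class_representative_maps (sym_group n)"
    and "character_enumeration F (sym_group n) r u\<^sub>0 \<xi>"
    and "\<Omega>bar \<subseteq> Omega_at F I (sym_group n) r u\<^sub>0"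
    and "\<forall>t \<in> RSC_type F I \<xi> ` Omega_at F I (sym_group n) r u\<^sub>0.
           \<exists>!R. R \<in> \<Omega>bar \<and> RSC_type F I \<xi> R = t"
  shows "\<Omega>bar \<subseteq> Omega F I (sym_group n) r \<and>
         (\<forall>R \<in> Omega F I (sym_group n) r. \<exists>!R'. R' \<in> \<Omega>bar \<and> RSC_isomorphic I I R R')"
proof
  show "\<Omega>bar \<subseteq> Omega F I (sym_group n) r"
    using assms(10) by (auto simp: Omega_at_def Omega_def)
  show "\<forall>R \<in> Omega F I (sym_group n) r. \<exists>!R'. R' \<in> \<Omega>bar \<and> RSC_isomorphic I I R R'"
    using representatives_if_automorphisms_inner[OF sym_group_automorphism_inner[OF assms(2)]
        assms(3,7,8,9,10,11)]
    by blast
qed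

end
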